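(* Let $d\ge3$ and consider the Boolean model in $\mathbb R^d$ whose grains are balls centred at the germs with deterministic radius $R>0$. Then the total visibility $\mathfrak V$ satisfies $$\liminf_{r\to+\infty}\frac1r\,\log\mathbb P\left(\mathfrak V\ge r\right)\ge-\omega_{d-1}R^{d-1}$$ and $$\limsup_{r\to+\infty}\frac1r\,\log\mathbb P\left(\mathfrak V\ge r\right)\le-\frac1d\,\omega_{d-1}R^{d-1}.$$
   Context: $\omega_k$ denotes the $k$-dimensional Lebesgue measure of the unit ball of $\mathbb R^k$. Let $\mathbf X$ be a homogeneous Poisson point process in $\mathbb R^d$ with intensity measure the Lebesgue measure. The occupied phase is $\mathfrak O=\bigcup_{x\in\mathbf X}B_d(x,R)$, where $B_d(x,R)$ is the ball of centre $x$ and radius $R$. The model is conditioned on the event $\{O\notin\mathfrak O\}$ (of positive probability), where $O$ is the origin; $\mathbb P$ denotes the probability under this conditioning. For a unit vector $\mathbf u\in\mathbb R^d$, $V(\mathbf u)=\inf\{s>0: s\mathbf u\in\mathfrak O\}$ (with $\inf\emptyset=+\infty$), and the total visibility is $\mathfrak V=\sup_{\|\mathbf u\|=1}V(\mathbf u)$. *)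

theory Defs
  imports "HOL-Probability.Probability"
begin

text \<open>
  Homogeneous Poisson point process of intensity Lebesgue measure. As this intensity has no
  atoms, the process is almost surely simple, so a configuration is represented by the (locally
  finite) set of its points. The Poisson weights are written out because \<open>poisson_pmf\<close> is only
  available for strictly positive rates, while \<open>B\<close> may be a null set. Since \<open>B\<close> is bounded,
  \<open>card\<close> is never applied to an infinite set.
\<close>
definition poisson_process :: "'w measure \<Rightarrow> ('w \<Rightarrow> 'a::euclidean_space set) \<Rightarrow> bool" where
  "poisson_process M X \<longleftrightarrow>
     prob_space M \<and>
     (\<forall>w\<in>space M. \<forall>B. bounded B \<longrightarrow> finite (X w \<inter> B)) \<and>
     (\<forall>B\<in>sets borel. bounded B \<longrightarrow>
        (\<lambda>w. card (X w \<inter> B)) \<in> measurable M (count_space UNIV)) \<and>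
     (\<forall>B\<in>sets borel. bounded B \<longrightarrow>
        (\<forall>k. measure M {w\<in>space M. card (X w \<inter> B) = k} =
              measure lborel B ^ k / fact k * exp (- measure lborel B))) \<and>
     (\<forall>(I::nat set) B. finite I \<longrightarrow> disjoint_family_on B I \<longrightarrow>
        (\<forall>i\<in>I. B i \<in> sets borel \<and> bounded (B i)) \<longrightarrow>
        prob_space.indep_vars M (\<lambda>_. count_space UNIV) (\<lambda>i w. card (X w \<inter> B i)) I)"

text \<open>The grains are closed balls, so the occupied phase of a locally finite set is closed.\<close>
definition occupied_phase :: "real \<Rightarrow> 'a::euclidean_space set \<Rightarrow> 'a set" where
  "occupied_phase R X = (\<Union>x\<in>X. cball x R)"

definition visibility :: "real \<Rightarrow> 'a::euclidean_space set \<Rightarrow> 'a \<Rightarrow> ereal" where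
  "visibility R X u = Inf {ereal s | s. s > 0 \<and> s *\<^sub>R u \<in> occupied_phase R X}"

definition total_visibility :: "real \<Rightarrow> 'a::euclidean_space set \<Rightarrow> ereal" where
  "total_visibility R X = (SUP u\<in>{u. norm u = 1}. visibility R X u)"

definition visibility_tail ::
    "'w measure \<Rightarrow> ('w \<Rightarrow> 'a::euclidean_space set) \<Rightarrow> real \<Rightarrow> real \<Rightarrow> real" where
  "visibility_tail M X R r =
     cond_prob M (\<lambda>w. ereal r \<le> total_visibility R (X w)) (\<lambda>w. 0 \<notin> occupied_phase R (X w))"

text \<open>The \<open>k\<close>-dimensional Lebesgue measure of the Euclidean unit ball of dimension \<open>k\<close>, with
  vectors indexed by \<open>{..<k}\<close>, since the dimension \<open>DIM('a) - 1\<close> is not available as a type.\<close>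
definition ball_volume :: "nat \<Rightarrow> real" where
  "ball_volume k =
     measure (Pi\<^sub>M {..<k} (\<lambda>_. lborel))
       {f \<in> space (Pi\<^sub>M {..<k} (\<lambda>_. lborel)). sqrt (\<Sum>i<k. (f i)\<^sup>2) \<le> 1}"

lemma ball_volume_eq_unit_ball_vol: "ball_volume k = unit_ball_vol (real k)"
proof -
  have "{f \<in> space (Pi\<^sub>M {..<k} (\<lambda>_. lborel::real measure)). sqrt (\<Sum>i<k. (f i)\<^sup>2) \<le> 1} =
        {f. sqrt (\<Sum>i<k. (f i)\<^sup>2) \<le> 1} \<inter> space (Pi\<^sub>M {..<k} (\<lambda>_. lborel))"
    by auto
  then show ?thesis
    using emeasure_cball_aux[of "{..<k}" 1] unfolding ball_volume_def by (simp add: measure_def)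
qed

end

theory Submission
  imports Defs "HOL-Real_Asymp.Real_Asymp"
begin

text \<open>
  A direction \<open>u\<close> is visible up to distance \<open>q\<close> iff no germ lies in the tube of radius \<open>R\<close> around
  the segment from \<open>0\<close> to \<open>q *\<^sub>R u\<close>, an event of probability \<open>exp (- vol)\<close>. A single tube of volume
  at most \<open>\<omega> R ^ (d - 1) (r + 2 R)\<close> gives the lower bound. For the upper bound, the sphere is
  covered by polynomially many (in \<open>r\<close>) directions, each standing for all directions within
  distance of order \<open>1 / r\<close>, at the price of shrinking the radius of the tubes to some \<open>\<rho> < R\<close>.
  A unit vector has a coordinate of modulus at least \<open>1 / sqrt d\<close>; slicing the tube orthogonally to
  that axis bounds its volume from below by \<open>q \<omega> \<rho> ^ (d - 1) / sqrt d\<close>. As \<open>1 / sqrt d > 1 / d\<close>,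
  there is room to choose \<open>\<rho>\<close> with \<open>\<rho> ^ (d - 1) = R ^ (d - 1) / sqrt d\<close>.
\<close>


section \<open>Volumes of sheared cylinders\<close>

lemma distr_PiM_lborel_plus:
  fixes c :: "'i \<Rightarrow> 'a::euclidean_space"
  assumes I: "finite I"
  shows "distr (\<Pi>\<^sub>M i\<in>I. lborel) (\<Pi>\<^sub>M i\<in>I. lborel) (\<lambda>f. \<lambda>i\<in>I. c i + f i) = (\<Pi>\<^sub>M i\<in>I. lborel)"
proof -
  interpret product_sigma_finite "\<lambda>_. lborel :: 'a measure"
    by standard
  show ?thesis
  proof (rule PiM_eqI)
    fix A :: "'i \<Rightarrow> 'a set" assume A: "\<And>i. i \<in> I \<Longrightarrow> A i \<in> sets lborel"
    have mA: "(+) (c i) -` A i \<in> sets lborel" if "i \<in> I" for i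
      using measurable_sets[of "(+) (c i)" borel borel "A i"] A[OF that] by simp
    have "(\<lambda>f. \<lambda>i\<in>I. c i + f i) -` Pi\<^sub>E I A \<inter> space (\<Pi>\<^sub>M i\<in>I. lborel) =
          (\<Pi>\<^sub>E i\<in>I. (+) (c i) -` A i)"
      by (auto simp: space_PiM PiE_def Pi_def)
    moreover have "emeasure lborel ((+) (c i) -` A i) = emeasure lborel (A i)" if "i \<in> I" for i
    proof -
      have "emeasure lborel (A i) = emeasure (distr lborel borel ((+) (c i))) (A i)"
        by (simp add: lborel_distr_plus)
      also have "\<dots> = emeasure lborel ((+) (c i) -` A i)"
        using A[OF that] by (subst emeasure_distr) auto
      finally show ?thesis by simp
    qed
    ultimately show "emeasure (distr (\<Pi>\<^sub>M i\<in>I. lborel) (\<Pi>\<^sub>M i\<in>I. lborel) (\<lambda>f. \<lambda>i\<in>I. c i + f i))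
        (Pi\<^sub>E I A) = (\<Prod>i\<in>I. emeasure lborel (A i))"
      using A mA I by (subst emeasure_distr) (auto simp: emeasure_PiM intro!: measurable_restrict sets_PiM_I_finite)
  qed (use I in auto)
qed

text \<open>Translation invariance moves the centre to the origin. Arbitrary centres are needed
  because the slices of a sheared cylinder drift along its axis.\<close>

lemma emeasure_PiM_translated_ball:
  fixes c :: "'i \<Rightarrow> real"
  assumes I: "finite I" and r: "r > 0"
  shows "emeasure (\<Pi>\<^sub>M i\<in>I. lborel)
           ({f. sqrt (\<Sum>i\<in>I. (f i - c i)\<^sup>2) \<le> r} \<inter> space (\<Pi>\<^sub>M i\<in>I. lborel)) =
         ennreal (unit_ball_vol (real (card I)) * r ^ card I)"
proof -
  let ?P = "\<Pi>\<^sub>M i\<in>I. (lborel :: real measure)" and ?T = "\<lambda>f. \<lambda>i\<in>I. c i + f i"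
  let ?S = "{f. sqrt (\<Sum>i\<in>I. (f i - c i)\<^sup>2) \<le> r} \<inter> space ?P"
  have S: "?S \<in> sets ?P"
    by measurable
  have "emeasure ?P ?S = emeasure (distr ?P ?P ?T) ?S"
    by (simp add: distr_PiM_lborel_plus[OF I])
  also have "\<dots> = emeasure ?P (?T -` ?S \<inter> space ?P)"
    using S by (subst emeasure_distr) auto
  also have "?T -` ?S \<inter> space ?P = {f. sqrt (\<Sum>i\<in>I. (f i)\<^sup>2) \<le> r} \<inter> space ?P"
    by (auto simp: space_PiM)
  finally show ?thesis
    using emeasure_cball_aux[OF I r] by simp
qed

text \<open>By Cavalieri's principle the direction \<open>c\<close> of the axis does not matter: the slice at
  height \<open>t\<close> is a ball centred at \<open>t *\<^sub>R c\<close>.\<close>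
lemma emeasure_sheared_cylinder:
  fixes b c :: "'a::euclidean_space"
  assumes b: "b \<in> Basis" and cb: "c \<bullet> b = 1" and A: "A \<in> sets borel" and r: "r > 0"
  shows "emeasure lborel {x. x \<bullet> b \<in> A \<and> norm (x - (x \<bullet> b) *\<^sub>R c) \<le> r} =
         emeasure lborel A * ennreal (unit_ball_vol (real (DIM('a) - 1)) * r ^ (DIM('a) - 1))"
proof -
  interpret product_sigma_finite "\<lambda>_. lborel :: real measure"
    by standard
  note [measurable] = A
  let ?I = "Basis - {b}" and ?S = "{x. x \<bullet> b \<in> A \<and> norm (x - (x \<bullet> b) *\<^sub>R c) \<le> r}"
  let ?v = "\<lambda>f. \<Sum>i\<in>(Basis::'a set). f i *\<^sub>R i"
  have ins: "insert b ?I = Basis"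
    using b by auto
  have S[measurable]: "?S \<in> sets borel"
    by measurable
  have slice: "?v (f(b := y)) \<in> ?S \<longleftrightarrow> y \<in> A \<and> sqrt (\<Sum>i\<in>?I. (f i - y * (c \<bullet> i))\<^sup>2) \<le> r" for f y
  proof -
    have coord: "?v (f(b := y)) \<bullet> i = (f(b := y)) i" if "i \<in> Basis" for i
      using that by (rule inner_sum_left_Basis)
    have "norm (?v (f(b := y)) - y *\<^sub>R c) =
          sqrt (\<Sum>i\<in>insert b ?I. (((f(b := y)) i - y * (c \<bullet> i)))\<^sup>2)"
      unfolding ins norm_eq_sqrt_inner
      by (subst euclidean_inner) (auto simp: inner_diff_left coord power2_eq_square simp del: fun_upd_apply intro!: sum.cong)
    \<comment> \<open>The \<open>b\<close>-coordinate drops out: it is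
      \<open>y - y * (c \<bullet> b)\<close>, and \<open>c \<bullet> b = 1\<close>.\<close>
    also have "\<dots> = sqrt (\<Sum>i\<in>?I. (f i - y * (c \<bullet> i))\<^sup>2)"
      using cb by (subst sum.insert) (auto intro!: sum.cong)
    finally show ?thesis
      using coord[OF b] by simp
  qed
  have "emeasure lborel ?S = (\<integral>\<^sup>+x. indicator ?S x \<partial>lborel)"
    by simp
  also have "\<dots> = (\<integral>\<^sup>+f. indicator ?S (?v f) \<partial>(\<Pi>\<^sub>M i\<in>insert b ?I. lborel))"
    unfolding ins by (subst lborel_eq, subst nn_integral_distr) auto
  \<comment> \<open>Tonelli, with the \<open>b\<close>-coordinate as the outer variable, so that the
    inner integral measures a slice.\<close>
  also have "\<dots> = (\<integral>\<^sup>+y. \<integral>\<^sup>+f. indicator ?S (?v (f(b := y))) \<partial>(\<Pi>\<^sub>M i\<in>?I. lborel) \<partial>lborel)"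
    by (rule product_nn_integral_insert_rev) (auto simp: ins)
  also have "\<dots> = (\<integral>\<^sup>+y. indicator A y * ennreal (unit_ball_vol (real (card ?I)) * r ^ card ?I) \<partial>lborel)"
  proof (rule nn_integral_cong)
    fix y :: real
    let ?B = "{f. sqrt (\<Sum>i\<in>?I. (f i - y * (c \<bullet> i))\<^sup>2) \<le> r} \<inter> space (\<Pi>\<^sub>M i\<in>?I. (lborel :: real measure))"
    have "(\<integral>\<^sup>+f. indicator ?S (?v (f(b := y))) \<partial>(\<Pi>\<^sub>M i\<in>?I. lborel)) =
          (\<integral>\<^sup>+f. indicator A y * indicator ?B f \<partial>(\<Pi>\<^sub>M i\<in>?I. lborel))"
    proof (rule nn_integral_cong)
      fix f assume "f \<in> space (\<Pi>\<^sub>M i\<in>?I. (lborel :: real measure))"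
      then have iff: "?v (f(b := y)) \<in> ?S \<longleftrightarrow> y \<in> A \<and> f \<in> ?B"
        unfolding slice by blast
      show "indicator ?S (?v (f(b := y))) = (indicator A y * indicator ?B f :: ennreal)"
        unfolding indicator_def iff by simp
    qed
    also have "\<dots> = indicator A y * emeasure (\<Pi>\<^sub>M i\<in>?I. lborel) ?B"
      by (subst nn_integral_cmult_indicator) auto
    also have "emeasure (\<Pi>\<^sub>M i\<in>?I. lborel) ?B =
        ennreal (unit_ball_vol (real (card ?I)) * r ^ card ?I)"
      by (rule emeasure_PiM_translated_ball) (use r in auto)
    finally show "(\<integral>\<^sup>+f. indicator ?S (?v (f(b := y))) \<partial>(\<Pi>\<^sub>M i\<in>?I. lborel)) =
        indicator A y * ennreal (unit_ball_vol (real (card ?I)) * r ^ card ?I)" .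
  qed
  also have "\<dots> = emeasure lborel A * ennreal (unit_ball_vol (real (card ?I)) * r ^ card ?I)"
    by (subst nn_integral_multc) auto
  finally show ?thesis
    using b by (simp add: card_Diff_singleton)
qed

section \<open>Tubes around segments and their volumes\<close>

definition tube :: "'a::euclidean_space \<Rightarrow> real \<Rightarrow> real \<Rightarrow> 'a set" where
  "tube u q r = (\<Union>s\<in>{0..q}. cball (s *\<^sub>R u) r)"

lemma mem_tube: "x \<in> tube u q r \<longleftrightarrow> (\<exists>s\<in>{0..q}. norm (x - s *\<^sub>R u) \<le> r)"
  by (auto simp: tube_def dist_norm norm_minus_commute)

lemma compact_tube: "compact (tube u q r)"
proof -
  have "tube u q r = (\<lambda>(s, y). s *\<^sub>R u + y) ` ({0..q} \<times> cball 0 r)"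
    by (force simp: mem_tube image_iff algebra_simps)
  moreover have "compact ((\<lambda>(s, y). s *\<^sub>R u + y) ` ({0..q} \<times> cball 0 r))"
    by (intro compact_continuous_image compact_Times)
       (auto intro!: continuous_intros simp: case_prod_beta)
  ultimately show ?thesis
    by simp
qed

lemma bounded_tube: "bounded (tube u q r)" and tube_borel: "tube u q r \<in> sets borel"
  using compact_tube[of u q r] by (auto simp: compact_imp_bounded borel_compact)

text \<open>Points with the same parameter \<open>s\<close> on the two segments are at most
  \<open>norm (u - u') * q\<close> apart, and the loss in radius pays for this. It lets one
  direction of a finite net stand for all directions near it.\<close>

lemma tube_subset_tube:
  assumes "norm (u - u') * q \<le> r - r'"
  shows "tube u' q r' \<subseteq> tube u q r"
proof
  fix x assume "x \<in> tube u' q r'"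
  then obtain s where s: "s \<in> {0..q}" "norm (x - s *\<^sub>R u') \<le> r'"
    by (auto simp: mem_tube)
  have "norm (x - s *\<^sub>R u) \<le> norm (x - s *\<^sub>R u') + norm (s *\<^sub>R (u - u'))"
    using norm_triangle_ineq4[of "x - s *\<^sub>R u'" "s *\<^sub>R (u - u')"] by (simp add: algebra_simps)
  also have "norm (s *\<^sub>R (u - u')) \<le> norm (u - u') * q"
    using s mult_right_mono[of s q "norm (u - u')"] by (simp add: mult.commute)
  finally show "x \<in> tube u q r"
    using s assms by (force simp: mem_tube)
qed

text \<open>Together with its rounded ends the tube fits into a straight cylinder of length
  \<open>q + 2 * r\<close>. A coordinate direction suffices, since the lower bound on the tail may
  choose its direction freely.\<close>

lemma measure_tube_Basis_le:
  fixes b :: "'a::euclidean_space"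
  assumes b: "b \<in> Basis" and q: "q \<ge> 0" and r: "r > 0"
  shows "measure lborel (tube b q r) \<le>
         (q + 2 * r) * (unit_ball_vol (real (DIM('a) - 1)) * r ^ (DIM('a) - 1))"
proof -
  let ?S = "{x. x \<bullet> b \<in> {-r..q + r} \<and> norm (x - (x \<bullet> b) *\<^sub>R b) \<le> r}"
  let ?V = "unit_ball_vol (real (DIM('a) - 1)) * r ^ (DIM('a) - 1)"
  have "tube b q r \<subseteq> ?S"
  proof
    fix x assume "x \<in> tube b q r"
    then obtain s where s: "s \<in> {0..q}" "norm (x - s *\<^sub>R b) \<le> r"
      by (auto simp: mem_tube)
    define y where "y = x - s *\<^sub>R b"
    have "\<bar>y \<bullet> b\<bar> \<le> r"
      using Basis_le_norm[OF b, of y] s(2) unfolding y_def by linarith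
    moreover have "x \<bullet> b = s + y \<bullet> b"
      using b by (simp add: y_def inner_diff_left)
    ultimately have "x \<bullet> b \<in> {-r..q + r}"
      using s by auto
    \<comment> \<open>Pythagoras: dropping the axial component of \<open>y\<close> cannot increase
      the norm.\<close>
    moreover have "(norm (y - (y \<bullet> b) *\<^sub>R b))\<^sup>2 + (y \<bullet> b)\<^sup>2 = (norm y)\<^sup>2"
      using b unfolding power2_norm_eq_inner
      by (simp add: inner_diff_left inner_diff_right inner_commute power2_eq_square)
    then have "(norm (y - (y \<bullet> b) *\<^sub>R b))\<^sup>2 \<le> (norm y)\<^sup>2"
      using zero_le_power2[of "y \<bullet> b"] by linarith
    then have "norm (y - (y \<bullet> b) *\<^sub>R b) \<le> r"
      using s(2) power2_le_imp_le[of "norm (y - (y \<bullet> b) *\<^sub>R b)" "norm y"]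
      unfolding y_def by (meson norm_ge_zero order_trans)
    moreover have "x - (x \<bullet> b) *\<^sub>R b = y - (y \<bullet> b) *\<^sub>R b"
      using b by (simp add: y_def inner_diff_left algebra_simps)
    ultimately show "x \<in> ?S"
      by simp
  qed
  then have "emeasure lborel (tube b q r) \<le> emeasure lborel ?S"
    by (intro emeasure_mono) auto
  also have "\<dots> = ennreal ((q + 2 * r) * ?V)"
    using b q r by (subst emeasure_sheared_cylinder) (auto simp: ennreal_mult' add_ac)
  finally show ?thesis
    using q r by (auto simp: measure_def intro!: enn2real_leI)
qed

text \<open>The tube contains a sheared cylinder whose slices orthogonal to \<open>b\<close> are
  balls of radius \<open>r\<close> centred on the segment; the extent of the segment in direction
  \<open>b\<close> is \<open>q * \<bar>u \<bullet> b\<bar>\<close>.\<close>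

lemma measure_tube_ge_coordinate:
  fixes u b :: "'a::euclidean_space"
  assumes b: "b \<in> Basis" and ub: "u \<bullet> b \<noteq> 0" and q: "q \<ge> 0" and r: "r > 0"
  shows "q * \<bar>u \<bullet> b\<bar> * (unit_ball_vol (real (DIM('a) - 1)) * r ^ (DIM('a) - 1))
           \<le> measure lborel (tube u q r)"
proof -
  let ?a = "u \<bullet> b"
  \<comment> \<open>The range of the \<open>b\<close>-coordinate along the segment, whose
    orientation depends on the sign of \<open>?a\<close>. Rescaling the axis to
    \<open>u /\<^sub>R ?a\<close> makes its \<open>b\<close>-coordinate 1, as shearing
    requires.\<close>
  let ?A = "if ?a > 0 then {0..q * ?a} else {q * ?a..0}"
  let ?S = "{x. x \<bullet> b \<in> ?A \<and> norm (x - (x \<bullet> b) *\<^sub>R (u /\<^sub>R ?a)) \<le> r}"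
  let ?V = "unit_ball_vol (real (DIM('a) - 1)) * r ^ (DIM('a) - 1)"
  have "?S \<subseteq> tube u q r"
  proof
    fix x assume x: "x \<in> ?S"
    then have "x \<bullet> b / ?a \<in> {0..q}"
      using ub by (auto simp: field_simps zero_le_divide_iff split: if_splits)
    moreover have "norm (x - (x \<bullet> b / ?a) *\<^sub>R u) \<le> r"
      using x by (simp add: divide_inverse)
    ultimately show "x \<in> tube u q r"
      by (auto simp: mem_tube simp del: atLeastAtMost_iff)
  qed
  then have "emeasure lborel ?S \<le> emeasure lborel (tube u q r)"
    by (intro emeasure_mono) (auto simp: tube_borel)
  also have "\<dots> = ennreal (measure lborel (tube u q r))"
    using emeasure_bounded_finite[OF bounded_tube, of u q r] by (intro emeasure_eq_ennreal_measure) simp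
  also have "emeasure lborel ?S = emeasure lborel ?A * ennreal ?V"
    using b ub r by (intro emeasure_sheared_cylinder) auto
  also have "emeasure lborel ?A = ennreal (q * \<bar>?a\<bar>)"
    using q by (auto simp: mult_nonneg_nonpos)
  also have "ennreal (q * \<bar>?a\<bar>) * ennreal ?V = ennreal (q * \<bar>?a\<bar> * ?V)"
    using q r by (simp add: ennreal_mult)
  finally show ?thesis
    by (simp add: ennreal_le_iff)
qed

text \<open>The squared coordinates add up to 1, so they cannot all lie below their average
  \<open>1 / DIM('a)\<close>.\<close>

lemma large_coordinate:
  fixes u :: "'a::euclidean_space"
  assumes "norm u = 1"
  obtains b where "b \<in> Basis" "\<bar>u \<bullet> b\<bar> \<ge> 1 / sqrt (real DIM('a))"
proof -
  have "\<exists>b\<in>Basis. \<bar>u \<bullet> b\<bar> \<ge> 1 / sqrt (real DIM('a))"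
  proof (rule ccontr)
    assume "\<not> ?thesis"
    then have lt: "\<bar>u \<bullet> b\<bar> < 1 / sqrt (real DIM('a))" if "b \<in> Basis" for b
      using that by force
    have "(u \<bullet> b)\<^sup>2 < 1 / real DIM('a)" if "b \<in> Basis" for b
      using power_strict_mono[OF lt[OF that], of 2] by (simp add: power_divide)
    then have "(\<Sum>b\<in>Basis. (u \<bullet> b)\<^sup>2) < (\<Sum>b\<in>(Basis::'a set). 1 / real DIM('a))"
      by (intro sum_strict_mono) auto
    moreover have "(\<Sum>b\<in>Basis. (u \<bullet> b)\<^sup>2) = (norm u)\<^sup>2"
      unfolding power2_norm_eq_inner by (subst euclidean_inner) (simp add: power2_eq_square)
    ultimately show False
      using assms by simp
  qed
  with that show ?thesis
    by blast
qed

lemma measure_tube_ge: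
  fixes u :: "'a::euclidean_space"
  assumes u: "norm u = 1" and q: "q \<ge> 0" and r: "r > 0"
  shows "q / sqrt (real DIM('a)) * (unit_ball_vol (real (DIM('a) - 1)) * r ^ (DIM('a) - 1))
           \<le> measure lborel (tube u q r)"
proof -
  obtain b where b: "b \<in> Basis" "\<bar>u \<bullet> b\<bar> \<ge> 1 / sqrt (real DIM('a))"
    using large_coordinate[OF u] .
  moreover from b have "u \<bullet> b \<noteq> 0"
    by (auto simp: not_le)
  ultimately have "q * \<bar>u \<bullet> b\<bar> * (unit_ball_vol (real (DIM('a) - 1)) * r ^ (DIM('a) - 1))
      \<le> measure lborel (tube u q r)"
    using q r by (intro measure_tube_ge_coordinate) auto
  moreover have "q * (1 / sqrt (real DIM('a))) \<le> q * \<bar>u \<bullet> b\<bar>"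
    using b q by (intro mult_left_mono) auto
  then have "q / sqrt (real DIM('a)) * (unit_ball_vol (real (DIM('a) - 1)) * r ^ (DIM('a) - 1))
      \<le> q * \<bar>u \<bullet> b\<bar> * (unit_ball_vol (real (DIM('a) - 1)) * r ^ (DIM('a) - 1))"
    using r by (intro mult_right_mono) auto
  ultimately show ?thesis
    by linarith
qed

section \<open>Finite nets on the unit sphere\<close>

lemma finite_sphere_net:
  assumes n: "n > 0"
  obtains F :: "'a::euclidean_space set"
  where "finite F" "F \<subseteq> {u. norm u = 1}" "card F \<le> (2 * n + 1) ^ DIM('a)"
    "\<And>u. norm u = 1 \<Longrightarrow> \<exists>u'\<in>F. norm (u - u') \<le> real DIM('a) / real n"
proof -
  define S where "S = {u :: 'a. norm u = 1}"
  \<comment> \<open>Directions are sorted by the cell of a grid of mesh \<open>1 / n\<close> that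
    contains them. \<open>F\<close> takes one unit vector from each cell that meets the sphere, so
    the net stays on the sphere.\<close>
  define cell where "cell u = (\<lambda>b\<in>Basis. \<lfloor>real n * (u \<bullet> b)\<rfloor>)" for u :: 'a
  define F where "F = inv_into S cell ` cell ` S"
  have "cell u \<in> (\<Pi>\<^sub>E b\<in>Basis. {- int n..int n})" if "u \<in> S" for u
  proof -
    have "\<bar>real n * (u \<bullet> b)\<bar> \<le> real n" if "b \<in> Basis" for b
      using Basis_le_norm[OF that, of u] \<open>u \<in> S\<close> n by (simp add: S_def abs_mult)
    then show ?thesis
      by (auto simp: cell_def abs_le_iff le_floor_iff floor_le_iff) (smt (verit))+
  qed
  then have sub: "cell ` S \<subseteq> (\<Pi>\<^sub>E b\<in>Basis. {- int n..int n})"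
    by blast
  have fin: "finite (\<Pi>\<^sub>E b\<in>(Basis :: 'a set). {- int n..int n})"
    by (intro finite_PiE) auto
  have "card F \<le> card (cell ` S)"
    unfolding F_def using finite_subset[OF sub fin] by (rule card_image_le)
  also have "\<dots> \<le> card (\<Pi>\<^sub>E b\<in>(Basis :: 'a set). {- int n..int n})"
    using fin sub by (rule card_mono)
  also have "\<dots> = (2 * n + 1) ^ DIM('a)"
    by (simp add: card_PiE nat_add_distrib nat_mult_distrib)
  finally have card: "card F \<le> (2 * n + 1) ^ DIM('a)" .
  have near: "\<exists>u'\<in>F. norm (u - u') \<le> real DIM('a) / real n" if u: "norm u = 1" for u
  proof -
    define u' where "u' = inv_into S cell (cell u)"
    have "cell u \<in> cell ` S"
      using u by (simp add: S_def)
    then have eq: "cell u' = cell u" and F: "u' \<in> F"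
      by (auto simp: u'_def F_def f_inv_into_f)
    have "\<bar>(u - u') \<bullet> b\<bar> \<le> 1 / real n" if "b \<in> Basis" for b
    proof -
      have "\<lfloor>real n * (u \<bullet> b)\<rfloor> = \<lfloor>real n * (u' \<bullet> b)\<rfloor>"
        using fun_cong[OF eq, of b] that by (simp add: cell_def)
      then have "\<bar>real n * (u \<bullet> b) - real n * (u' \<bullet> b)\<bar> \<le> 1"
        by linarith
      also have "real n * (u \<bullet> b) - real n * (u' \<bullet> b) = real n * ((u - u') \<bullet> b)"
        by (simp add: algebra_simps)
      finally show ?thesis
        using n by (simp add: abs_mult field_simps)
    qed
    \<comment> \<open>The crude comparison with the l1 norm is enough: only the order
      \<open>1 / n\<close> of the distance matters later.\<close>
    then have "(\<Sum>b\<in>Basis. \<bar>(u - u') \<bullet> b\<bar>) \<le> (\<Sum>b\<in>(Basis::'a set). 1 / real n)"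
      by (rule sum_mono)
    with norm_le_l1[of "u - u'"] have "norm (u - u') \<le> real DIM('a) / real n"
      by simp
    with F show ?thesis
      by blast
  qed
  have "finite F" "F \<subseteq> S"
    using finite_subset[OF sub fin] by (auto simp: F_def intro: inv_into_into)
  with card near show ?thesis
    by (intro that) (auto simp: S_def)
qed

section \<open>Visibility expressed by empty tubes\<close>

lemma disjoint_tube_iff:
  "X \<inter> tube u q R = {} \<longleftrightarrow> (\<forall>s\<in>{0..q}. s *\<^sub>R u \<notin> occupied_phase R X)"
  by (auto simp: disjoint_iff tube_def occupied_phase_def dist_commute)

lemma disjoint_cball_iff: "X \<inter> cball 0 R = {} \<longleftrightarrow> 0 \<notin> occupied_phase R X"
  by (auto simp: occupied_phase_def)

lemma visibility_nonneg: "0 \<le> visibility R X u"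
  unfolding visibility_def by (intro Inf_greatest) auto

lemma le_visibility:
  assumes "X \<inter> tube u q R = {}"
  shows "ereal q \<le> visibility R X u"
  unfolding visibility_def
proof (rule Inf_greatest)
  fix t assume "t \<in> {ereal s | s. s > 0 \<and> s *\<^sub>R u \<in> occupied_phase R X}"
  with assms show "ereal q \<le> t"
    by (force simp: disjoint_tube_iff)
qed

text \<open>The infimum ranges over \<open>s > 0\<close> only; the end point \<open>s = 0\<close> of
  the segment is covered by the conditioning event.\<close>

lemma disjoint_tube_if_less_visibility:
  assumes 0: "0 \<notin> occupied_phase R X" and q: "ereal q < visibility R X u"
  shows "X \<inter> tube u q R = {}"
  unfolding disjoint_tube_iff
proof
  fix s assume s: "s \<in> {0..q}"
  show "s *\<^sub>R u \<notin> occupied_phase R X"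
  proof
    assume occ: "s *\<^sub>R u \<in> occupied_phase R X"
    with 0 s have "s > 0"
      by (cases "s = 0") auto
    with occ have "visibility R X u \<le> ereal s"
      unfolding visibility_def by (intro Inf_lower) auto
    also have "\<dots> \<le> ereal q"
      using s by simp
    finally show False
      using q by simp
  qed
qed

lemma le_total_visibility:
  assumes "norm u = 1" "X \<inter> tube u q R = {}"
  shows "ereal q \<le> total_visibility R X"
  using le_visibility[OF assms(2)] assms(1) unfolding total_visibility_def
  by (intro SUP_upper2[of u]) auto

text \<open>The supremum over directions need not be attained, hence the strictly smaller length
  \<open>q\<close>.\<close>

lemma total_visibility_imp_disjoint_tube:
  assumes "0 \<notin> occupied_phase R X" "ereal r \<le> total_visibility R X" "q < r"
  obtains u where "norm u = 1" "X \<inter> tube u q R = {}"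
proof -
  have "ereal q < total_visibility R X"
    using assms(2,3) by (meson less_ereal.simps(1) less_le_trans)
  then obtain u where "norm u = 1" "ereal q < visibility R X u"
    by (auto simp: total_visibility_def less_SUP_iff)
  from this(1) disjoint_tube_if_less_visibility[OF assms(1) this(2)] show ?thesis
    by (rule that)
qed

text \<open>A partial converse that tests only countably many lengths, as measurability demands. The
  direction may change with \<open>q\<close>, since a supremum is only approached from
  below.\<close>

lemma le_total_visibilityI_rational:
  fixes X :: "'a::euclidean_space set"
  assumes "\<And>q. q \<in> \<rat> \<Longrightarrow> 0 < q \<Longrightarrow> q < r \<Longrightarrow> \<exists>u. norm u = 1 \<and> X \<inter> tube u q R = {}"
  shows "ereal r \<le> total_visibility R X"
proof (rule ccontr)
  assume "\<not> ?thesis"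
  then obtain q :: rat where q: "total_visibility R X < ereal (of_rat q)" "ereal (of_rat q) < ereal r"
    using ereal_dense3[of "total_visibility R X" "ereal r"] by (auto simp: not_le)
  obtain b :: 'a where "b \<in> Basis"
    using nonempty_Basis by blast
  then have "visibility R X b \<le> total_visibility R X"
    unfolding total_visibility_def by (intro SUP_upper) auto
  with visibility_nonneg[of R X b] q(1) have "0 < ereal (of_rat q)"
    by (meson le_less_trans order_trans)
  with assms[of "of_rat q"] q(2) obtain u where "norm u = 1" "X \<inter> tube u (of_rat q) R = {}"
    by auto
  from le_total_visibility[OF this] q(1) show False
    by simp
qed

text \<open>Only finitely many germs are near the tube, so their distances to the segment stay above
  some \<open>m > R\<close>, and a small turn of the segment cannot bring any of them within
  \<open>R\<close>.\<close>

lemma open_disjoint_tube: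
  fixes X :: "'a::euclidean_space set"
  assumes fin: "\<And>B. bounded B \<Longrightarrow> finite (X \<inter> B)"
  shows "open {u. X \<inter> tube u q R = {}}"
  unfolding open_dist
proof (intro ballI)
  fix u assume "u \<in> {u. X \<inter> tube u q R = {}}"
  then have u: "X \<inter> tube u q R = {}"
    by simp
  \<comment> \<open>The margin 1 ensures that every germ reached after moving the points of the
    segment by less than 1 is already in \<open>Y\<close>.\<close>
  define Y where "Y = X \<inter> tube u q (R + 1)"
  have "compact Y"
    unfolding Y_def by (intro finite_imp_compact fin bounded_tube)
  then have "compact (Y \<times> {0..q})"
    by (intro compact_Times compact_Icc)
  moreover have "continuous_on (Y \<times> {0..q}) (\<lambda>p. norm (fst p - snd p *\<^sub>R u))"
    by (intro continuous_intros)
  ultimately have "\<exists>m>R. \<forall>y\<in>Y. \<forall>s\<in>{0..q}. m \<le> norm (y - s *\<^sub>R u)"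
  proof (cases "Y \<times> {0..q} = {}")
    case False
    assume "compact (Y \<times> {0..q})" "continuous_on (Y \<times> {0..q}) (\<lambda>p. norm (fst p - snd p *\<^sub>R u))"
    from continuous_attains_inf[OF this(1) False this(2)]
    obtain y0 s0 where "y0 \<in> Y" "s0 \<in> {0..q}"
      "\<And>y s. y \<in> Y \<Longrightarrow> s \<in> {0..q} \<Longrightarrow> norm (y0 - s0 *\<^sub>R u) \<le> norm (y - s *\<^sub>R u)"
      by fastforce
    moreover from this have "norm (y0 - s0 *\<^sub>R u) > R"
      using u by (force simp: Y_def mem_tube not_le[symmetric])
    ultimately show ?thesis
      by blast
  qed (auto intro: exI[of _ "R + 1"])
  then obtain m where m: "m > R" "\<And>y s. y \<in> Y \<Longrightarrow> s \<in> {0..q} \<Longrightarrow> m \<le> norm (y - s *\<^sub>R u)"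
    by blast
  \<comment> \<open>Turning by less than \<open>e\<close> moves each point of the segment by less
    than \<open>min 1 (m - R)\<close>: the 1 keeps the germ in \<open>Y\<close>, the
    \<open>m - R\<close> contradicts the choice of \<open>m\<close>. The added 1 keeps the
    denominator positive.\<close>
  define e where "e = min 1 (m - R) / (\<bar>q\<bar> + 1)"
  have e: "e > 0"
    using m by (simp add: e_def)
  moreover have "X \<inter> tube v q R = {}" if v: "dist v u < e" for v
  proof (rule ccontr)
    assume "X \<inter> tube v q R \<noteq> {}"
    then obtain x s where x: "x \<in> X" and s: "s \<in> {0..q}" "norm (x - s *\<^sub>R v) \<le> R"
      by (blast elim: mem_tube[THEN iffD1, THEN bexE])
    have "norm (v - u) * (\<bar>q\<bar> + 1) < min 1 (m - R)"
      using v by (simp add: dist_norm e_def pos_less_divide_eq)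
    moreover have "norm (s *\<^sub>R (v - u)) \<le> norm (v - u) * (\<bar>q\<bar> + 1)"
      using s mult_right_mono[of s "\<bar>q\<bar> + 1" "norm (v - u)"] by (simp add: mult.commute)
    ultimately have "norm (s *\<^sub>R (v - u)) < min 1 (m - R)"
      by linarith
    moreover have "norm (x - s *\<^sub>R u) \<le> norm (x - s *\<^sub>R v) + norm (s *\<^sub>R (v - u))"
      using norm_triangle_ineq[of "x - s *\<^sub>R v" "s *\<^sub>R (v - u)"] by (simp add: algebra_simps)
    ultimately have xu: "norm (x - s *\<^sub>R u) < R + min 1 (m - R)"
      using s by linarith
    with s x have "x \<in> Y"
      by (force simp: Y_def mem_tube)
    from m(2)[OF this s(1)] xu show False
      by simp
  qed
  ultimately show "\<exists>e>0. \<forall>v. dist v u < e \<longrightarrow> v \<in> {u. X \<inter> tube u q R = {}}"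
    by blast
qed

section \<open>Void probabilities and measurability\<close>

lemma poisson_process_void:
  assumes pp: "poisson_process M X" and B: "B \<in> sets borel" "bounded B"
  shows poisson_process_void_sets: "{w \<in> space M. X w \<inter> B = {}} \<in> sets M"
    and poisson_process_void_prob:
      "measure M {w \<in> space M. X w \<inter> B = {}} = exp (- measure lborel B)"
proof -
  \<comment> \<open>Local finiteness matters here, because \<open>card\<close> also vanishes on
    infinite sets.\<close>
  have eq: "{w \<in> space M. X w \<inter> B = {}} = {w \<in> space M. card (X w \<inter> B) = 0}"
    using pp B(2) by (auto simp: poisson_process_def card_eq_0_iff)
  have "(\<lambda>w. card (X w \<inter> B)) \<in> measurable M (count_space UNIV)"
    using pp B by (simp add: poisson_process_def)
  from measurable_sets[OF this, of "{0}"] show "{w \<in> space M. X w \<inter> B = {}} \<in> sets M"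
    unfolding eq by (simp add: vimage_def Int_def conj_commute)
  have "measure M {w \<in> space M. card (X w \<inter> B) = 0} =
      measure lborel B ^ 0 / fact 0 * exp (- measure lborel B)"
    using pp B unfolding poisson_process_def by blast
  then show "measure M {w \<in> space M. X w \<inter> B = {}} = exp (- measure lborel B)"
    unfolding eq by simp
qed

text \<open>For a fixed length the directions along which a locally finite configuration leaves the tube
  empty form an open set, so the supremum over the sphere reduces to a countable dense set.\<close>
lemma sets_total_visibility_ge:
  fixes X :: "'w \<Rightarrow> 'a::euclidean_space set"
  assumes pp: "poisson_process M X"
  shows "{w \<in> space M. ereal r \<le> total_visibility R (X w) \<and> 0 \<notin> occupied_phase R (X w)} \<in> sets M"
proof -
  obtain D :: "'a set" where D: "countable D" "D \<subseteq> sphere 0 1" "sphere 0 1 \<subseteq> closure D"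
    using separable .
  let ?Q = "{q \<in> \<rat>. 0 < q \<and> q < r}"
  have "ereal r \<le> total_visibility R (X w) \<longleftrightarrow> (\<forall>q\<in>?Q. \<exists>u\<in>D. X w \<inter> tube u q R = {})"
    if w: "w \<in> space M" "0 \<notin> occupied_phase R (X w)" for w
  proof
    assume vis: "ereal r \<le> total_visibility R (X w)"
    show "\<forall>q\<in>?Q. \<exists>u\<in>D. X w \<inter> tube u q R = {}"
    proof
      fix q assume "q \<in> ?Q"
      then obtain u where u: "norm u = 1" "X w \<inter> tube u q R = {}"
        using total_visibility_imp_disjoint_tube[OF w(2) vis] by blast
      have "open {u. X w \<inter> tube u q R = {}}"
        using pp w(1) by (intro open_disjoint_tube) (auto simp: poisson_process_def)
      moreover have "u \<in> closure D"
        using D u by auto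
      ultimately have "D \<inter> {u. X w \<inter> tube u q R = {}} \<noteq> {}"
        using u(2) open_Int_closure_eq_empty[of "{u. X w \<inter> tube u q R = {}}" D] by blast
      then show "\<exists>u\<in>D. X w \<inter> tube u q R = {}"
        by blast
    qed
  next
    assume "\<forall>q\<in>?Q. \<exists>u\<in>D. X w \<inter> tube u q R = {}"
    then show "ereal r \<le> total_visibility R (X w)"
      using D(2) by (intro le_total_visibilityI_rational) (force simp: subset_iff)
  qed
  \<comment> \<open>The conditioning event is itself the absence of germs from a ball, so the whole
    event is a countable combination of void events.\<close>
  then have "{w \<in> space M. ereal r \<le> total_visibility R (X w) \<and> 0 \<notin> occupied_phase R (X w)} =
      {w \<in> space M. (\<forall>q\<in>?Q. \<exists>u\<in>D. X w \<inter> tube u q R = {}) \<and> X w \<inter> cball 0 R = {}}"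
    by (auto simp: disjoint_cball_iff)
  moreover have "countable ?Q"
    using countable_rat by (rule countable_subset[rotated]) auto
  ultimately show ?thesis
    using D(1) by (simp only:) (intro sets.sets_Collect_conj sets.sets_Collect_countable_All'
        sets.sets_Collect_countable_Ex' poisson_process_void_sets[OF pp] tube_borel bounded_tube
        borel_closed closed_cball bounded_cball)
qed

section \<open>Bounds on the tail at a fixed distance\<close>

lemma visibility_tail_eq:
  fixes X :: "'w \<Rightarrow> 'a::euclidean_space set"
  assumes pp: "poisson_process M X"
  shows "visibility_tail M X R r =
    measure M {w \<in> space M. ereal r \<le> total_visibility R (X w) \<and> 0 \<notin> occupied_phase R (X w)} *
    exp (measure lborel (cball (0::'a) R))"
proof -
  have "measure M {w \<in> space M. 0 \<notin> occupied_phase R (X w)} = exp (- measure lborel (cball (0::'a) R))"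
    using poisson_process_void_prob[OF pp, of "cball 0 R"] by (simp add: disjoint_cball_iff)
  then show ?thesis
    unfolding visibility_tail_def cond_prob_def by (simp add: exp_minus divide_inverse)
qed

lemma visibility_tail_ge:
  fixes X :: "'w \<Rightarrow> 'a::euclidean_space set"
  assumes pp: "poisson_process M X" and R: "R > 0" and r: "r \<ge> 0"
  shows "exp (- ((r + 2 * R) * (unit_ball_vol (real (DIM('a) - 1)) * R ^ (DIM('a) - 1))))
           \<le> visibility_tail M X R r"
proof -
  interpret prob_space M
    using pp by (simp add: poisson_process_def)
  obtain b :: 'a where b: "b \<in> Basis"
    using nonempty_Basis by blast
  let ?E = "{w \<in> space M. ereal r \<le> total_visibility R (X w) \<and> 0 \<notin> occupied_phase R (X w)}"
  have "exp (- ((r + 2 * R) * (unit_ball_vol (real (DIM('a) - 1)) * R ^ (DIM('a) - 1))))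
      \<le> exp (- measure lborel (tube b r R))"
    using measure_tube_Basis_le[OF b r R] by simp
  also have "\<dots> = prob {w \<in> space M. X w \<inter> tube b r R = {}}"
    by (rule poisson_process_void_prob[OF pp tube_borel bounded_tube, symmetric])
  also have "\<dots> \<le> prob ?E"
  proof (rule finite_measure_mono)
    \<comment> \<open>The tube contains the ball around the origin (\<open>s = 0\<close>), so its
      emptiness already implies the conditioning event.\<close>
    have "0 \<notin> occupied_phase R (X w)" if "X w \<inter> tube b r R = {}" for w
      using that r by (force simp: disjoint_tube_iff)
    then show "{w \<in> space M. X w \<inter> tube b r R = {}} \<subseteq> ?E"
      using b by (auto intro: le_total_visibility[of b])
  qed (rule sets_total_visibility_ge[OF pp])
  \<comment> \<open>Conditioning multiplies the joint probability by a factor of at least 1.\<close>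
  also have "\<dots> \<le> visibility_tail M X R r"
    unfolding visibility_tail_eq[OF pp]
    using mult_left_mono[of 1 "exp (measure lborel (cball (0::'a) R))" "prob ?E"] by simp
  finally show ?thesis .
qed

text \<open>Union bound over the net: a visible direction has an empty tube of radius
  \<open>R\<close>, which contains the tube of radius \<open>\<rho>\<close> along a nearby direction
  of the net.\<close>

lemma visibility_tail_le:
  fixes X :: "'w \<Rightarrow> 'a::euclidean_space set"
  assumes pp: "poisson_process M X" and \<rho>: "\<rho> > 0"
    and q: "q \<ge> 0" "q < r" and n: "n > 0" "q * real DIM('a) / real n \<le> R - \<rho>"
  shows "visibility_tail M X R r \<le> real (2 * n + 1) ^ DIM('a) *
    exp (- (q / sqrt (real DIM('a)) * (unit_ball_vol (real (DIM('a) - 1)) * \<rho> ^ (DIM('a) - 1)))) *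
    exp (measure lborel (cball (0::'a) R))"
proof -
  interpret prob_space M
    using pp by (simp add: poisson_process_def)
  let ?E = "{w \<in> space M. ereal r \<le> total_visibility R (X w) \<and> 0 \<notin> occupied_phase R (X w)}"
  let ?V = "\<lambda>u. {w \<in> space M. X w \<inter> tube u q \<rho> = {}}"
  let ?p = "exp (- (q / sqrt (real DIM('a)) *
    (unit_ball_vol (real (DIM('a) - 1)) * \<rho> ^ (DIM('a) - 1))))"
  obtain F :: "'a set" where F: "finite F" "F \<subseteq> {u. norm u = 1}" "card F \<le> (2 * n + 1) ^ DIM('a)"
    "\<And>u. norm u = 1 \<Longrightarrow> \<exists>u'\<in>F. norm (u - u') \<le> real DIM('a) / real n"
    using finite_sphere_net[OF n(1)] by blast
  have V: "?V u \<in> events" for u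
    by (rule poisson_process_void_sets[OF pp tube_borel bounded_tube])
  have "?E \<subseteq> (\<Union>u\<in>F. ?V u)"
  proof
    fix w assume "w \<in> ?E"
    then have w: "w \<in> space M" "ereal r \<le> total_visibility R (X w)" "0 \<notin> occupied_phase R (X w)"
      by auto
    obtain u where u: "norm u = 1" "X w \<inter> tube u q R = {}"
      using total_visibility_imp_disjoint_tube[OF w(3,2) q(2)] .
    obtain u' where u': "u' \<in> F" "norm (u - u') \<le> real DIM('a) / real n"
      using F(4)[OF u(1)] by blast
    have "norm (u - u') * q \<le> R - \<rho>"
      using mult_right_mono[OF u'(2) q(1)] n(2) by (simp add: mult.commute)
    from tube_subset_tube[OF this] u(2) w(1) u'(1) show "w \<in> (\<Union>u\<in>F. ?V u)"
      by blast
  qed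
  then have "prob ?E \<le> prob (\<Union>u\<in>F. ?V u)"
    using F(1) V by (intro finite_measure_mono) auto
  also have "\<dots> \<le> (\<Sum>u\<in>F. prob (?V u))"
    using F(1) V by (intro finite_measure_subadditive_finite) auto
  also have "\<dots> \<le> (\<Sum>u\<in>F. ?p)"
  proof (rule sum_mono)
    fix u assume "u \<in> F"
    then show "prob (?V u) \<le> ?p"
      using measure_tube_ge[OF _ q(1) \<rho>, of u] F(2)
      by (auto simp: poisson_process_void_prob[OF pp tube_borel bounded_tube])
  qed
  also have "\<dots> \<le> real (2 * n + 1) ^ DIM('a) * ?p"
    using of_nat_mono[OF F(3), where ?'a = real] by simp
  finally show ?thesis
    unfolding visibility_tail_eq[OF pp] by (intro mult_right_mono) simp_all
qed

section \<open>Exponential decay rates\<close>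

theorem proposition4p1:
  fixes M :: "'w measure" and X :: "'w \<Rightarrow> 'a::euclidean_space set" and R :: real
  assumes "DIM('a) \<ge> 3"
    and "R > 0"
    and "poisson_process M X"
  shows "Liminf at_top (\<lambda>r::real. ereal (1 / r * ln (visibility_tail M X R r)))
           \<ge> ereal (- ball_volume (DIM('a) - 1) * R ^ (DIM('a) - 1)) \<and>
         Limsup at_top (\<lambda>r::real. ereal (1 / r * ln (visibility_tail M X R r)))
           \<le> ereal (- (1 / real DIM('a)) * ball_volume (DIM('a) - 1) * R ^ (DIM('a) - 1))"
proof
  define d where "d = DIM('a)"
  define K where "K = unit_ball_vol (real (d - 1)) * R ^ (d - 1)"
  let ?f = "visibility_tail M X R"
  note pp = assms(3)
  have d: "d \<ge> 3" and R: "R > 0"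
    using assms by (auto simp: d_def)
  have lower: "exp (- ((r + 2 * R) * K)) \<le> ?f r" if "r \<ge> 0" for r
    using visibility_tail_ge[OF pp R that] by (simp add: K_def d_def)
  \<comment> \<open>Both halves need this to compare logarithms.\<close>
  have pos: "?f r > 0" if "r \<ge> 0" for r
    using lower[OF that] by (meson exp_gt_zero less_le_trans)
  show "Liminf at_top (\<lambda>r. ereal (1 / r * ln (?f r)))
      \<ge> ereal (- ball_volume (DIM('a) - 1) * R ^ (DIM('a) - 1))"
  proof -
    have "((\<lambda>r. 1 / r * - ((r + 2 * R) * K)) \<longlongrightarrow> - K) at_top"
      by real_asymp
    then have "ereal (- K) = Liminf at_top (\<lambda>r. ereal (1 / r * - ((r + 2 * R) * K)))"
      by (intro lim_imp_Liminf[symmetric] tendsto_ereal) auto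
    also have "\<dots> \<le> Liminf at_top (\<lambda>r. ereal (1 / r * ln (?f r)))"
    proof (rule Liminf_mono)
      show "\<forall>\<^sub>F r in at_top. ereal (1 / r * - ((r + 2 * R) * K)) \<le> ereal (1 / r * ln (?f r))"
        using eventually_gt_at_top[of 0]
      proof eventually_elim
        case (elim r)
        then show ?case
          using lower[of r] pos[of r] unfolding ereal_less_eq(3)
          by (intro mult_left_mono) (auto simp: ln_ge_iff)
      qed
    qed
    finally show ?thesis
      by (simp add: K_def d_def ball_volume_eq_unit_ball_vol)
  qed
  show "Limsup at_top (\<lambda>r. ereal (1 / r * ln (?f r)))
      \<le> ereal (- (1 / real DIM('a)) * ball_volume (DIM('a) - 1) * R ^ (DIM('a) - 1))"
  proof -
    \<comment> \<open>Chosen so that shrinking the radius by the factor \<open>c\<close> costs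
      exactly \<open>1 / sqrt d\<close>. With the factor \<open>1 / sqrt d\<close> from the slicing,
      this makes the rate \<open>K / d\<close>.\<close>
    define c where "c = root (d - 1) (1 / sqrt (real d))"
    define \<rho> where "\<rho> = c * R"
    have c: "c > 0" "c < 1" "c ^ (d - 1) = 1 / sqrt (real d)"
      using d by (auto simp: c_def real_root_lt_1_iff)
    then have \<rho>: "0 < \<rho>" "\<rho> < R"
      using R by (auto simp: \<rho>_def)
    have K\<rho>: "q / sqrt (real d) * (unit_ball_vol (real (d - 1)) * \<rho> ^ (d - 1)) = q * (K / real d)" for q
    proof -
      have "\<rho> ^ (d - 1) = R ^ (d - 1) / sqrt (real d)"
        unfolding \<rho>_def power_mult_distrib c(3) by simp
      then show ?thesis
        by (simp add: K_def)
    qed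
    \<comment> \<open>With \<open>n \<ge> a * r\<close> the net is fine enough for the loss of
      radius: \<open>r * d / n \<le> R - \<rho>\<close>.\<close>
    define a where "a = real d / (R - \<rho>)"
    define A where "A = measure lborel (cball (0::'a) R)"
    have a: "a > 0"
      using \<rho> d by (simp add: a_def)
    \<comment> \<open>The length \<open>q = r - 1\<close> meets the requirement
      \<open>q < r\<close>. The shift by 1, the constant \<open>A\<close> and the logarithm of the
      size of the net all vanish after division by \<open>r\<close>.\<close>
    have upper: "ln (?f r) \<le> real d * ln (2 * a * r + 3) - (r - 1) * (K / real d) + A" if r: "r > 1" for r
    proof -
      define n where "n = nat \<lceil>a * r\<rceil>"
      have "a * r > 0"
        using a r by simp
      then have n: "n > 0" "a * r \<le> real n" "real n \<le> a * r + 1"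
        unfolding n_def by linarith+
      have "(r - 1) * real d / real n \<le> R - \<rho>"
      proof -
        have "real d * r \<le> (R - \<rho>) * real n"
          using n(2) \<rho> by (simp add: a_def field_simps)
        moreover have "(r - 1) * real d \<le> real d * r"
          by (simp add: algebra_simps)
        ultimately show ?thesis
          using n(1) by (simp add: field_simps)
      qed
      then have "?f r \<le> real (2 * n + 1) ^ d * exp (- ((r - 1) * (K / real d))) * exp A"
        using visibility_tail_le[OF pp \<rho>(1), of "r - 1" r n R] r n(1)
        unfolding d_def[symmetric] K\<rho> A_def[symmetric] by simp
      then have "ln (?f r) \<le> ln (real (2 * n + 1) ^ d * exp (- ((r - 1) * (K / real d))) * exp A)"
        using pos[of r] r by (intro ln_mono) auto
      also have "\<dots> = real d * ln (real (2 * n + 1)) - (r - 1) * (K / real d) + A"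
        by (simp add: ln_mult ln_realpow)
      also have "real d * ln (real (2 * n + 1)) \<le> real d * ln (2 * a * r + 3)"
        using n by (intro mult_left_mono ln_mono) auto
      finally show ?thesis
        by simp
    qed
    have "((\<lambda>r. 1 / r * (real d * ln (2 * a * r + 3) - (r - 1) * (K / real d) + A)) \<longlongrightarrow> - (K / real d)) at_top"
      using a by real_asymp
    then have lim: "Limsup at_top (\<lambda>r. ereal (1 / r * (real d * ln (2 * a * r + 3) - (r - 1) * (K / real d) + A)))
        = ereal (- (K / real d))"
      by (intro lim_imp_Limsup tendsto_ereal) auto
    have "Limsup at_top (\<lambda>r. ereal (1 / r * ln (?f r)))
        \<le> Limsup at_top (\<lambda>r. ereal (1 / r * (real d * ln (2 * a * r + 3) - (r - 1) * (K / real d) + A)))"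
    proof (rule Limsup_mono)
      show "\<forall>\<^sub>F r in at_top. ereal (1 / r * ln (?f r))
          \<le> ereal (1 / r * (real d * ln (2 * a * r + 3) - (r - 1) * (K / real d) + A))"
        using eventually_gt_at_top[of 1]
      proof eventually_elim
        case (elim r)
        then show ?case
          using upper[of r] unfolding ereal_less_eq(3) by (intro mult_left_mono) auto
      qed
    qed
    also note lim
    finally show ?thesis
      by (simp add: K_def d_def ball_volume_eq_unit_ball_vol)
  qed
qed

end
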